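(* Let $n\ge2$. For $1\le k\le n$ let $Q^{(n)}_k$ be the $n\times n$ real matrix with entries ($i$th row, $j$th column) $\left(Q^{(n)}_k\right)_{i,j}=\delta_{i,k}\,\mathrm{sgn}(j-k)$, and let $M^{(n)}_k=\frac{2}{n-1}Q^{(n)}_k$. Let $\psi_n$ be the ordered measure on $[0,n)$ with density $M^{(n)}_k$ on $[k-1,k)$ for $k=1,\dots,n$. Then the cumulative norm of $\psi_n$ in the $\ell^1$ operator norm $\|\cdot\|_{\ell^1}$ of $n\times n$ matrices is $$\int\|\psi_n\|_{\ell^1}=\frac{2n}{n-1},$$ while the Magnus expansion of $\psi_n$ is not absolutely convergent.
   Context: $\mathrm{sgn}(0)=0$ and $\delta$ is Kronecker's delta. For an atomless matrix-valued measure $\phi$ of finite variation on an interval $I$ (an ordered measure), the cumulative norm $\int\|\phi\|$ is its total variation with respect to $\|\cdot\|$; for $\psi_n$ it is $\sum_{k=1}^n\|M^{(n)}_k\|_{\ell^1}$. The $\ell^1$ operator norm is the operator norm induced by the $\ell^1$ norm on column vectors. Magnus terms: for $t_1,\dots,t_k\in I$ let $\mathrm{asc}$ (resp. $\mathrm{des}$) be the number of $i<k$ with $t_i<t_{i+1}$ (resp. $t_i>t_{i+1}$). Then $$\mu_{k,\mathrm R}(\phi)=\int_{(t_1,\dots,t_k)\in I^k}(-1)^{\mathrm{des}(t_1,\dots,t_k)}\frac{\mathrm{asc}(t_1,\dots,t_k)!\,\mathrm{des}(t_1,\dots,t_k)!}{k!}\,\phi(t_1)\cdots\phi(t_k).$$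 Equivalently, $\sum_k t^k\mu_{k,\mathrm R}(\phi)=\log\exp_{\mathrm R}(t\phi)$ as formal power series in $t$, where $\exp_{\mathrm R}(\phi)=1+\sum_{k\ge1}\int_{t_1\le\dots\le t_k}\phi(t_1)\cdots\phi(t_k)$ is the time-ordered exponential; in particular $\exp_{\mathrm R}(t\psi_n)=\exp(tM^{(n)}_1)\cdots\exp(tM^{(n)}_n)$. The Magnus expansion of $\phi$ is the series $\sum_{k\ge1}\mu_{k,\mathrm R}(\phi)$; it is absolutely convergent if $\sum_k\|\mu_{k,\mathrm R}(\phi)\|<\infty$. *)

theory Defs
  imports
    "HOL-Analysis.Set_Integral"
    "HOL-Analysis.Lebesgue_Measure"
    "HOL-Library.Disjoint_Sets"
    "Jordan_Normal_Form.Matrix"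
begin

definition l1_norm_vec :: "real vec \<Rightarrow> real" where
  "l1_norm_vec v = (\<Sum>i<dim_vec v. \<bar>vec_index v i\<bar>)"

definition l1_opnorm :: "real mat \<Rightarrow> real" where
  "l1_opnorm A = (SUP v \<in> {v \<in> carrier_vec (dim_col A). l1_norm_vec v \<le> 1}. l1_norm_vec (A *\<^sub>v v))"


text \<open>
  An ordered measure $\phi$ with values in the real $d \times d$ matrices is given by a finite
  atomless measure \<open>m\<close> on the reals, whose space is the interval $I$, and a density \<open>h\<close>, with
  $\phi(A) = \int_A h \, dm$. Every matrix-valued measure of finite variation arises in this way,
  with its total variation as \<open>m\<close>; in integrals, $\phi(t)$ stands for $h(t) \, m(dt)$.
  Integrals of matrices are taken entrywise. Matrix entries are indexed from 0.
\<close>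

definition ordered_measure :: "nat \<Rightarrow> real measure \<Rightarrow> (real \<Rightarrow> real mat) \<Rightarrow> real set \<Rightarrow> real mat" where
  "ordered_measure d m h A = mat d d (\<lambda>(i, j). set_lebesgue_integral m A (\<lambda>t. h t $$ (i, j)))"

text \<open>The total variation with respect to the norm \<open>N\<close>; it is a supremum in the extended reals.\<close>

definition cumulative_norm ::
  "(real mat \<Rightarrow> real) \<Rightarrow> nat \<Rightarrow> real measure \<Rightarrow> (real \<Rightarrow> real mat) \<Rightarrow> ereal" where
  "cumulative_norm N d m h =
     (SUP P \<in> {P. finite P \<and> P \<subseteq> sets m \<and> partition_on (space m) P}.
        ereal (\<Sum>A\<in>P. N (ordered_measure d m h A)))"

definition asc :: "nat \<Rightarrow> (nat \<Rightarrow> real) \<Rightarrow> nat" where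
  "asc k t = card {i \<in> {1..<k}. t i < t (i + 1)}"

definition des :: "nat \<Rightarrow> (nat \<Rightarrow> real) \<Rightarrow> nat" where
  "des k t = card {i \<in> {1..<k}. t i > t (i + 1)}"

text \<open>The product $h(t_1) \cdots h(t_k)$, in this order.\<close>

definition ordered_prod :: "nat \<Rightarrow> (real \<Rightarrow> real mat) \<Rightarrow> nat \<Rightarrow> (nat \<Rightarrow> real) \<Rightarrow> real mat" where
  "ordered_prod d h k t = foldr (\<lambda>i A. h (t i) * A) [1..<Suc k] (1\<^sub>m d)"

definition magnus_term ::
  "nat \<Rightarrow> real measure \<Rightarrow> (real \<Rightarrow> real mat) \<Rightarrow> nat \<Rightarrow> real mat" where
  "magnus_term d m h k = mat d d (\<lambda>(i, j).
     (LINT t | Pi\<^sub>M {1..k} (\<lambda>_. m).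
        (-1) ^ des k t * (fact (asc k t) * fact (des k t) / fact k) * ordered_prod d h k t $$ (i, j)))"

text \<open>The Magnus series starts at $k = 1$.\<close>

definition magnus_absolutely_convergent ::
  "(real mat \<Rightarrow> real) \<Rightarrow> nat \<Rightarrow> real measure \<Rightarrow> (real \<Rightarrow> real mat) \<Rightarrow> bool" where
  "magnus_absolutely_convergent N d m h \<longleftrightarrow> summable (\<lambda>k. N (magnus_term d m h (Suc k)))"


text \<open>Here \<open>k\<close> ranges over $1, \dots, n$, so the 0-based row \<open>i\<close> is the row $i + 1$.\<close>

definition Q_mat :: "nat \<Rightarrow> nat \<Rightarrow> real mat" where
  "Q_mat n k = mat n n (\<lambda>(i, j). of_bool (i + 1 = k) * sgn (real (j + 1) - real k))"

definition M_mat :: "nat \<Rightarrow> nat \<Rightarrow> real mat" where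
  "M_mat n k = (2 / (real n - 1)) \<cdot>\<^sub>m Q_mat n k"

definition psi_base :: "nat \<Rightarrow> real measure" where
  "psi_base n = restrict_space lborel {0..<real n}"

text \<open>The intervals $[k-1, k)$ are disjoint, so only one summand is nonzero.\<close>

definition psi_density :: "nat \<Rightarrow> real \<Rightarrow> real mat" where
  "psi_density n t =
     mat n n (\<lambda>(i, j). \<Sum>k = 1..n. indicator {real k - 1..<real k} t * M_mat n k $$ (i, j))"

end

theory Submission
  imports Defs
begin

text \<open>
  Since $Q_a Q_b = \mathrm{sgn}(b - a)\, e_a w_b^T$, where $e_a$ is the column unit vector and $w_b^T$
  is the nonzero row of $Q_b$, the product $Q_{a_1} \cdots Q_{a_k}$ is
  $(-1)^{\mathrm{des}(a)} e_{a_1} w_{a_k}^T$ if consecutive indices are distinct and 0 otherwise.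
  The signs cancel those in the Magnus formula, hence the last column of the $k$th Magnus term is
  nonnegative, with sum
  $(2/(n-1))^k \sum_a \mathrm{asc}(a)!\, \mathrm{des}(a)!/k!$ over the sequences without
  consecutive repetitions that do not end in $n$. There are $(n-1)^k$ of them, and
  $\mathrm{asc}!\, \mathrm{des}!/k! \ge 1/(k\, 2^{k-1})$ because a binomial coefficient of $k-1$ is at most
  $2^{k-1}$. So the $k$th term has norm at least $2/k$, and the series diverges by
  comparison with the harmonic series.
\<close>

section \<open>The l1 operator norm and column sums\<close>

lemma l1_norm_unit_vec: "j < m \<Longrightarrow> l1_norm_vec (unit_vec m j) = 1"
  by (simp add: l1_norm_vec_def unit_vec_def if_distrib cong: if_cong)

text \<open>The triangle inequality in each row, followed by an exchange of the two sums, makes each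
  column sum the coefficient of one |v_j|.\<close>

lemma l1_norm_mult_mat_vec_le:
  assumes col: "\<And>j. j < dim_col A \<Longrightarrow> (\<Sum>i<dim_row A. \<bar>A $$ (i, j)\<bar>) \<le> C"
    and v: "v \<in> carrier_vec (dim_col A)"
  shows "l1_norm_vec (A *\<^sub>v v) \<le> C * l1_norm_vec v"
proof -
  have "l1_norm_vec (A *\<^sub>v v) = (\<Sum>i<dim_row A. \<bar>\<Sum>j<dim_col A. A $$ (i, j) * vec_index v j\<bar>)"
    using v by (simp add: l1_norm_vec_def scalar_prod_def lessThan_atLeast0 row_def)
  also have "\<dots> \<le> (\<Sum>i<dim_row A. \<Sum>j<dim_col A. \<bar>A $$ (i, j)\<bar> * \<bar>vec_index v j\<bar>)"
    by (intro sum_mono order.trans[OF sum_abs]) (simp add: abs_mult)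
  also have "\<dots> = (\<Sum>j<dim_col A. (\<Sum>i<dim_row A. \<bar>A $$ (i, j)\<bar>) * \<bar>vec_index v j\<bar>)"
    by (subst sum.swap) (simp add: sum_distrib_right)
  also have "\<dots> \<le> (\<Sum>j<dim_col A. C * \<bar>vec_index v j\<bar>)"
    using col by (intro sum_mono mult_right_mono) auto
  also have "\<dots> = C * l1_norm_vec v"
    using v by (simp add: l1_norm_vec_def sum_distrib_left)
  finally show ?thesis .
qed

text \<open>Serves the supremum in \<open>l1_opnorm\<close> twice: as the estimate in
  \<open>l1_opnorm_le\<close> and as boundedness in \<open>column_sum_le_l1_opnorm\<close>.\<close>

lemma l1_norm_mult_mat_vec_le_bound:
  assumes "\<And>j. j < dim_col A \<Longrightarrow> (\<Sum>i<dim_row A. \<bar>A $$ (i, j)\<bar>) \<le> C" and "C \<ge> 0"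
    and "v \<in> carrier_vec (dim_col A)" "l1_norm_vec v \<le> 1"
  shows "l1_norm_vec (A *\<^sub>v v) \<le> C"
  using assms(2,4)
  by (intro order.trans[OF l1_norm_mult_mat_vec_le[OF assms(1,3)]] mult_left_le) simp_all

lemma l1_unit_ball_nonempty: "{v \<in> carrier_vec m. l1_norm_vec v \<le> 1} \<noteq> {}"
  by (auto simp: l1_norm_vec_def intro!: exI[of _ "0\<^sub>v m"])

lemma l1_opnorm_le:
  assumes "\<And>j. j < dim_col A \<Longrightarrow> (\<Sum>i<dim_row A. \<bar>A $$ (i, j)\<bar>) \<le> C" and "C \<ge> 0"
  shows "l1_opnorm A \<le> C"
  unfolding l1_opnorm_def
  by (intro cSUP_least l1_unit_ball_nonempty)
    (simp add: l1_norm_mult_mat_vec_le_bound[OF assms])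

text \<open>The jth unit vector has norm 1 and is mapped to the jth column.\<close>

lemma column_sum_le_l1_opnorm:
  assumes j: "j < dim_col A"
  shows "(\<Sum>i<dim_row A. \<bar>A $$ (i, j)\<bar>) \<le> l1_opnorm A"
proof -
  \<comment> \<open>A crude common bound of all column sums; it only shows that the supremum is over
    a bounded set, as \<open>cSUP_upper\<close> demands on the reals.\<close>
  define C where "C = (\<Sum>j<dim_col A. \<Sum>i<dim_row A. \<bar>A $$ (i, j)\<bar>)"
  have "C \<ge> 0"
    by (simp add: C_def sum_nonneg)
  have col: "(\<Sum>i<dim_row A. \<bar>A $$ (i, j)\<bar>) \<le> C" if "j < dim_col A" for j
    unfolding C_def using that by (intro member_le_sum) (auto simp: sum_nonneg)
  have "l1_norm_vec (A *\<^sub>v unit_vec (dim_col A) j) \<le> l1_opnorm A"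
    unfolding l1_opnorm_def using j l1_norm_mult_mat_vec_le_bound[OF col \<open>C \<ge> 0\<close>]
    by (intro cSUP_upper bdd_aboveI2[where M = C]) (auto simp: l1_norm_unit_vec)
  moreover have "l1_norm_vec (A *\<^sub>v unit_vec (dim_col A) j) = (\<Sum>i<dim_row A. \<bar>A $$ (i, j)\<bar>)"
    using j by (auto simp: l1_norm_vec_def intro!: sum.cong)
  ultimately show ?thesis
    by simp
qed

section \<open>Lebesgue measure on [0,n), its unit intervals and the density\<close>

lemma sets_psi_base: "A \<in> sets (psi_base n) \<longleftrightarrow> A \<in> sets lborel \<and> A \<subseteq> {0..<real n}"
  by (auto simp: psi_base_def sets_restrict_space_iff)

lemma space_psi_base: "space (psi_base n) = {0..<real n}"
  by (simp add: psi_base_def space_restrict_space)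

lemma emeasure_psi_base:
  "A \<in> sets (psi_base n) \<Longrightarrow> emeasure (psi_base n) A = emeasure lborel A"
  by (simp add: psi_base_def emeasure_restrict_space sets_restrict_space_iff)

lemma finite_measure_psi_base: "finite_measure (psi_base n)"
proof
  have "{0..<real n} \<in> sets (psi_base n)"
    by (simp add: sets_psi_base)
  then show "emeasure (psi_base n) (space (psi_base n)) \<noteq> \<infinity>"
    by (simp add: space_psi_base emeasure_psi_base)
qed

lemma unit_interval_psi_base:
  assumes "i < n"
  shows "{real i..<real i + 1} \<in> sets (psi_base n)"
    and "emeasure (psi_base n) {real i..<real i + 1} = 1"
    and "measure (psi_base n) {real i..<real i + 1} = 1"
proof -
  show *: "{real i..<real i + 1} \<in> sets (psi_base n)"
    using assms by (auto simp: sets_psi_base)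
  show "emeasure (psi_base n) {real i..<real i + 1} = 1"
    using * by (simp add: emeasure_psi_base)
  then show "measure (psi_base n) {real i..<real i + 1} = 1"
    by (simp add: measure_def)
qed

lemma measure_psi_base_space: "measure (psi_base n) {0..<real n} = real n"
proof -
  have "{0..<real n} \<in> sets (psi_base n)"
    by (simp add: sets_psi_base)
  then show ?thesis
    by (simp add: measure_def emeasure_psi_base)
qed

text \<open>Row i, counted from 0, is nonzero only in the matrix with 1-based index
  \<open>Suc i\<close>, so of the sum over k only this summand survives, and its interval [k-1,k) is
  [i,i+1).\<close>

lemma psi_density_index:
  assumes "i < n" "j < n"
  shows "psi_density n t $$ (i, j) =
    indicator {real i..<real i + 1} t * (2 / (real n - 1) * sgn (real j - real i))"
proof -
  let ?e = "indicator {real i..<real i + 1} t * (2 / (real n - 1) * sgn (real j - real i))"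
  have summand: "indicator {real k - 1..<real k} t * M_mat n k $$ (i, j)
      = (if k = Suc i then ?e else 0)" for k
    using assms by (simp add: M_mat_def Q_mat_def add.commute)
  have "psi_density n t $$ (i, j) = (\<Sum>k = 1..n. if k = Suc i then ?e else 0)"
    using assms by (simp only: psi_density_def index_mat(1) prod.case summand)
  also have "\<dots> = ?e"
    using assms by simp
  finally show ?thesis .
qed

section \<open>The cumulative norm\<close>

lemma ordered_measure_psi_index:
  assumes "i < n" "j < n" "A \<in> sets (psi_base n)"
  shows "ordered_measure n (psi_base n) (psi_density n) A $$ (i, j) =
    2 / (real n - 1) * sgn (real j - real i) * measure (psi_base n) (A \<inter> {real i..<real i + 1})"
proof -
  have "A \<inter> {real i..<real i + 1} \<in> sets (psi_base n)"
    using assms unit_interval_psi_base(1) by blast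
  moreover have "(LINT t|psi_base n. indicator A t *\<^sub>R psi_density n t $$ (i, j)) =
    (LINT t|psi_base n. 2 / (real n - 1) * sgn (real j - real i)
        * indicator (A \<inter> {real i..<real i + 1}) t)"
    using assms by (intro Bochner_Integration.integral_cong)
      (auto simp: psi_density_index indicator_def)
  ultimately show ?thesis
    using assms sets.sets_into_space
    by (simp add: ordered_measure_def set_lebesgue_integral_def Int_absorb2)
qed

text \<open>Finite additivity: each x in [0,n) lies in the unit interval that starts at its
  floor.\<close>

lemma measure_psi_base_split:
  assumes "A \<in> sets (psi_base n)"
  shows "(\<Sum>i<n. measure (psi_base n) (A \<inter> {real i..<real i + 1})) = measure (psi_base n) A"
proof -
  have A: "A = (\<Union>i<n. A \<inter> {real i..<real i + 1})"
  proof (intro equalityI subsetI)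
    fix x assume "x \<in> A"
    moreover from this have "0 \<le> x" "x < real n"
      using assms by (auto simp: sets_psi_base)
    then have "nat \<lfloor>x\<rfloor> < n" "real (nat \<lfloor>x\<rfloor>) \<le> x" "x < real (nat \<lfloor>x\<rfloor>) + 1"
      by linarith+
    ultimately show "x \<in> (\<Union>i<n. A \<inter> {real i..<real i + 1})"
      by auto
  qed auto
  have "disjoint_family_on (\<lambda>i. A \<inter> {real i..<real i + 1}) {..<n}"
    by (auto simp: disjoint_family_on_def)
  moreover have "(\<lambda>i. A \<inter> {real i..<real i + 1}) ` {..<n} \<subseteq> sets (psi_base n)"
    using assms unit_interval_psi_base(1) by blast
  ultimately have "(\<Sum>i<n. measure (psi_base n) (A \<inter> {real i..<real i + 1}))
      = measure (psi_base n) (\<Union>i<n. A \<inter> {real i..<real i + 1})"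
    by (intro finite_measure.finite_measure_finite_Union[OF finite_measure_psi_base, symmetric]) auto
  then show ?thesis
    by (simp only: A[symmetric])
qed

text \<open>Let c = 2/(n-1). Every column sum of the measure of A is at most c times the length of
  A, because its ith entry is bounded by c times the length of the part of A in [i,i+1). Additivity
  then bounds the sum over any partition by c n. The partition into unit intervals attains this, as
  each of them has norm at least c.\<close>

lemma cumulative_norm_psi:
  assumes "n \<ge> 2"
  shows "cumulative_norm l1_opnorm n (psi_base n) (psi_density n) = ereal (2 * real n / (real n - 1))"
  unfolding cumulative_norm_def
proof (rule antisym)
  let ?om = "ordered_measure n (psi_base n) (psi_density n)"
  let ?c = "2 / (real n - 1)"
  have c: "?c > 0"
    using assms by simp
  have upper: "l1_opnorm (?om A) \<le> ?c * measure (psi_base n) A" if A: "A \<in> sets (psi_base n)" for A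
  proof (rule l1_opnorm_le)
    fix j assume "j < dim_col (?om A)"
    then have "j < n"
      by (simp add: ordered_measure_def)
    have "(\<Sum>i<dim_row (?om A). \<bar>?om A $$ (i, j)\<bar>)
        \<le> (\<Sum>i<n. ?c * measure (psi_base n) (A \<inter> {real i..<real i + 1}))"
    \<comment> \<open>\<open>sum_mono2\<close> only passes from the index bound
      \<open>dim_row (?om A)\<close> to \<open>n\<close>, which are equal; the estimate itself is
      the first subgoal.\<close>
    proof (rule sum_mono2[THEN order.trans[rotated]])
      show "(\<Sum>i<dim_row (?om A). \<bar>?om A $$ (i, j)\<bar>)
        \<le> (\<Sum>i<dim_row (?om A). ?c * measure (psi_base n) (A \<inter> {real i..<real i + 1}))"
      proof (rule sum_mono)
        fix i assume "i \<in> {..<dim_row (?om A)}"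
        then have "i < n"
          by (simp add: ordered_measure_def)
        then show "\<bar>?om A $$ (i, j)\<bar> \<le> ?c * measure (psi_base n) (A \<inter> {real i..<real i + 1})"
          using \<open>j < n\<close> A c
          by (simp add: ordered_measure_psi_index abs_mult abs_sgn_eq divide_right_mono)
      qed
    qed (use c in \<open>auto simp: ordered_measure_def\<close>)
    also have "\<dots> = ?c * measure (psi_base n) A"
      by (simp only: sum_distrib_left[symmetric] measure_psi_base_split[OF A])
    finally show "(\<Sum>i<dim_row (?om A). \<bar>?om A $$ (i, j)\<bar>) \<le> ?c * measure (psi_base n) A" .
  qed (use c in simp)
  show "(SUP P\<in>{P. finite P \<and> P \<subseteq> sets (psi_base n) \<and> partition_on (space (psi_base n)) P}.
      ereal (\<Sum>A\<in>P. l1_opnorm (?om A))) \<le> ereal (2 * real n / (real n - 1))"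
  proof (rule SUP_least)
    fix P assume "P \<in> {P. finite P \<and> P \<subseteq> sets (psi_base n) \<and> partition_on (space (psi_base n)) P}"
    then have P: "finite P" "P \<subseteq> sets (psi_base n)" "partition_on (space (psi_base n)) P"
      by auto
    have "(\<Sum>A\<in>P. l1_opnorm (?om A)) \<le> (\<Sum>A\<in>P. ?c * measure (psi_base n) A)"
      using P upper by (intro sum_mono) blast
    also have "\<dots> = ?c * measure (psi_base n) (\<Union>A\<in>P. A)"
      using P by (subst finite_measure.finite_measure_finite_Union[OF finite_measure_psi_base])
        (auto simp: sum_distrib_left partition_on_def disjoint_family_on_def disjoint_def)
    also have "\<dots> = 2 * real n / (real n - 1)"
      using P(3) by (simp add: partition_on_def space_psi_base measure_psi_base_space)
    finally show "ereal (\<Sum>A\<in>P. l1_opnorm (?om A)) \<le> ereal (2 * real n / (real n - 1))"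
      by simp
  qed
  define P where "P = (\<lambda>i. {real i..<real i + 1}) ` {..<n}"
  \<comment> \<open>Distinct intervals for distinct i, so that the sum over the set \<open>P\<close>
    has n summands.\<close>
  have inj: "inj_on (\<lambda>i. {real i..<real i + 1}) {..<n}"
    by (auto simp: inj_on_def Ico_eq_Ico)
  have "partition_on (space (psi_base n)) P"
  proof (rule partition_onI)
    show "\<Union>P = space (psi_base n)"
    proof (intro equalityI subsetI)
      fix x assume "x \<in> space (psi_base n)"
      then have "nat \<lfloor>x\<rfloor> < n" "real (nat \<lfloor>x\<rfloor>) \<le> x" "x < real (nat \<lfloor>x\<rfloor>) + 1"
        unfolding space_psi_base atLeastLessThan_iff by linarith+
      then show "x \<in> \<Union>P"
        by (auto simp: P_def)
    qed (auto simp: P_def space_psi_base)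
  next
    fix p q assume "p \<in> P" "q \<in> P" "p \<noteq> q"
    then obtain i l where "p = {real i..<real i + 1}" "q = {real l..<real l + 1}" "i \<noteq> l"
      by (auto simp: P_def)
    then show "disjnt p q"
      by (auto simp: disjnt_def)
  qed (auto simp: P_def)
  then have P: "P \<in> {P. finite P \<and> P \<subseteq> sets (psi_base n) \<and> partition_on (space (psi_base n)) P}"
    using unit_interval_psi_base(1) by (auto simp: P_def)
  have lower: "?c \<le> l1_opnorm (?om {real i..<real i + 1})" if "i < n" for i
  proof -
    \<comment> \<open>Some column off the diagonal, where the entry does not vanish; it exists
      because \<open>n \<ge> 2\<close>.\<close>
    define j where "j = (if i = 0 then 1 else 0 :: nat)"
    have j: "j < n" "j \<noteq> i"
      using assms by (auto simp: j_def)
    let ?A = "?om {real i..<real i + 1}"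
    have dims: "dim_row ?A = n" "dim_col ?A = n"
      by (simp_all add: ordered_measure_def)
    have "?c = \<bar>?A $$ (i, j)\<bar>"
      using that j c unit_interval_psi_base[OF that]
      by (simp add: ordered_measure_psi_index abs_mult abs_sgn_eq)
    also have "\<dots> \<le> (\<Sum>i<n. \<bar>?A $$ (i, j)\<bar>)"
      using that by (intro member_le_sum) auto
    also have "\<dots> \<le> l1_opnorm ?A"
      using column_sum_le_l1_opnorm[of j ?A] j dims by simp
    finally show ?thesis .
  qed
  have "2 * real n / (real n - 1) = (\<Sum>i<n. ?c)"
    by simp
  also have "\<dots> \<le> (\<Sum>i<n. l1_opnorm (?om {real i..<real i + 1}))"
    using lower by (intro sum_mono) auto
  also have "\<dots> = (\<Sum>A\<in>P. l1_opnorm (?om A))"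
    unfolding P_def by (simp add: sum.reindex[OF inj])
  finally show "ereal (2 * real n / (real n - 1)) \<le>
    (SUP P\<in>{P. finite P \<and> P \<subseteq> sets (psi_base n) \<and> partition_on (space (psi_base n)) P}.
      ereal (\<Sum>A\<in>P. l1_opnorm (?om A)))"
    using P by (intro SUP_upper2[of P]) auto
qed

section \<open>Reduction of integrals over the cube to finite sums\<close>

text \<open>The unit boxes with integer corners tile the cube [0,n)^k and have measure 1. A function
  that is constant on each box agrees on the space with a finite combination of box indicators,
  which also settles its measurability.\<close>

lemma integral_PiM_psi_base:
  fixes f :: "(nat \<Rightarrow> real) \<Rightarrow> real"
  assumes f: "\<And>a t. a \<in> {1..k} \<rightarrow>\<^sub>E {..<n} \<Longrightarrow>
    (\<And>l. l \<in> {1..k} \<Longrightarrow> real (a l) \<le> t l \<and> t l < real (a l) + 1) \<Longrightarrow> f t = F a"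
  shows "(LINT t|Pi\<^sub>M {1..k} (\<lambda>_. psi_base n). f t) = (\<Sum>a\<in>{1..k} \<rightarrow>\<^sub>E {..<n}. F a)"
proof -
  have "finite_product_sigma_finite (\<lambda>_. psi_base n) {1..k}"
    using finite_measure.axioms(1)[OF finite_measure_psi_base]
    by (intro finite_product_sigma_finite.intro finite_product_sigma_finite_axioms.intro
      product_sigma_finite.intro) simp_all
  note measure_times = finite_product_sigma_finite.measure_times[OF this]
  define box where "box a = (\<Pi>\<^sub>E l\<in>{1..k}. {real (a l)..<real (a l) + 1})" for a :: "nat \<Rightarrow> nat"
  let ?M = "Pi\<^sub>M {1..k} (\<lambda>_. psi_base n)"
  have fin: "finite ({1..k} \<rightarrow>\<^sub>E {..<n})"
    by (intro finite_PiE) auto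
  have box: "box a \<in> sets ?M" "emeasure ?M (box a) = 1" if a: "a \<in> {1..k} \<rightarrow>\<^sub>E {..<n}" for a
  proof -
    have al: "a l < n" if "l \<in> {1..k}" for l
      using PiE_mem[OF a that] by simp
    show "box a \<in> sets ?M"
      unfolding box_def using al by (intro sets_PiM_I_finite unit_interval_psi_base(1)) auto
    show "emeasure ?M (box a) = 1"
      unfolding box_def using al by (subst measure_times) (auto simp: unit_interval_psi_base)
  qed
  have "(LINT t|?M. f t) = (LINT t|?M. (\<Sum>a\<in>{1..k} \<rightarrow>\<^sub>E {..<n}. F a * indicator (box a) t))"
  proof (intro Bochner_Integration.integral_cong refl)
    fix t assume t: "t \<in> space ?M"
    \<comment> \<open>The corner of the box that contains \<open>t\<close>; \<open>restrict\<close>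
      makes it extensional, as membership in the set of index functions requires.\<close>
    define b where "b = restrict (\<lambda>l. nat \<lfloor>t l\<rfloor>) {1..k}"
    have tl: "0 \<le> t l" "t l < real n" if "l \<in> {1..k}" for l
      using t that by (auto simp: space_PiM space_psi_base)
    have bl: "b l < n \<and> real (b l) \<le> t l \<and> t l < real (b l) + 1" if "l \<in> {1..k}" for l
      using tl[OF that] that unfolding b_def by simp linarith
    have b: "b \<in> {1..k} \<rightarrow>\<^sub>E {..<n}"
      using bl by (auto simp: b_def)
    have "t \<in> box a \<longleftrightarrow> a = b" if a: "a \<in> {1..k} \<rightarrow>\<^sub>E {..<n}" for a
    proof
      assume "t \<in> box a"
      then have al: "real (a l) \<le> t l \<and> t l < real (a l) + 1" if "l \<in> {1..k}" for l
        using that by (auto simp: box_def)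
      show "a = b"
      proof (rule PiE_ext[OF a b])
        fix l assume "l \<in> {1..k}"
        from al[OF this] bl[OF this] show "a l = b l" by linarith
      qed
    next
      assume "a = b"
      then show "t \<in> box a"
        using bl t by (auto simp: box_def space_PiM PiE_iff)
    qed
    then have "(\<Sum>a\<in>{1..k} \<rightarrow>\<^sub>E {..<n}. F a * indicator (box a) t)
        = (\<Sum>a\<in>{1..k} \<rightarrow>\<^sub>E {..<n}. if a = b then F b else 0)"
      by (intro sum.cong) auto
    also have "\<dots> = F b"
      using fin b by simp
    also have "\<dots> = f t"
      using f[OF b] bl by simp
    finally show "f t = (\<Sum>a\<in>{1..k} \<rightarrow>\<^sub>E {..<n}. F a * indicator (box a) t)" ..
  qed
  also have "\<dots> = (\<Sum>a\<in>{1..k} \<rightarrow>\<^sub>E {..<n}. (LINT t|?M. F a * indicator (box a) t))"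
    using box by (intro Bochner_Integration.integral_sum integrable_mult_right
      integrable_real_indicator) auto
  also have "\<dots> = (\<Sum>a\<in>{1..k} \<rightarrow>\<^sub>E {..<n}. F a)"
    using box sets.sets_into_space
    by (intro sum.cong) (auto simp: measure_def Int_absorb2)
  finally show ?thesis .
qed

section \<open>Products of the matrices\<close>

lemma ordered_prod_carrier:
  assumes "\<And>x. h x \<in> carrier_mat d d"
  shows "foldr (\<lambda>i A. h (t i) * A) xs (1\<^sub>m d) \<in> carrier_mat d d"
  by (induction xs) (auto intro!: mult_carrier_mat assms)

text \<open>The fold exposes the first factor, whereas the induction over k needs the last one.
  Associativity pulls the initial value of the fold out to the right.\<close>

lemma ordered_prod_Suc:
  assumes h: "\<And>x. h x \<in> carrier_mat d d"
  shows "ordered_prod d h (Suc k) t = ordered_prod d h k t * h (t (Suc k))"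
proof -
  have "foldr (\<lambda>i A. h (t i) * A) xs B = foldr (\<lambda>i A. h (t i) * A) xs (1\<^sub>m d) * B"
    if "B \<in> carrier_mat d d" for xs B
  proof (induction xs)
    case (Cons x xs)
    have "h (t x) * foldr (\<lambda>i A. h (t i) * A) xs (1\<^sub>m d) * B
        = h (t x) * (foldr (\<lambda>i A. h (t i) * A) xs (1\<^sub>m d) * B)"
      by (rule assoc_mult_mat[OF h ordered_prod_carrier[OF h] that])
    then show ?case
      using Cons.IH by simp
  qed (use that in simp)
  from this[of "h (t (Suc k)) * 1\<^sub>m d"] show ?thesis
    using h[of "t (Suc k)"] by (simp add: ordered_prod_def)
qed

text \<open>At a time in [b,b+1) the density has b as its only nonzero row. Multiplying by it on the
  right therefore selects column b of the previous product and contributes a factor 2/(n-1) and a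
  sign.\<close>

lemma ordered_prod_psi:
  assumes k: "k \<ge> 1" and ij: "i < n" "j < n"
    and a: "\<And>l. l \<in> {1..k} \<Longrightarrow> a l < n"
    and t: "\<And>l. l \<in> {1..k} \<Longrightarrow> real (a l) \<le> t l \<and> t l < real (a l) + 1"
  shows "ordered_prod n (psi_density n) k t $$ (i, j) =
    (2 / (real n - 1)) ^ k * of_bool (a 1 = i) *
      (\<Prod>l\<in>{1..<k}. sgn (real (a (l + 1)) - real (a l))) * sgn (real j - real (a k))"
  using k a t ij(2)
proof (induction k arbitrary: j rule: nat_induct_at_least)
  case base
  have "psi_density n (t 1) \<in> carrier_mat n n"
    by (simp add: psi_density_def)
  moreover have "psi_density n (t 1) $$ (i, j) =
      of_bool (a 1 = i) * (2 / (real n - 1) * sgn (real j - real (a 1)))"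
    using base(2)[of 1] base(3) ij(1) by (auto simp: psi_density_index indicator_def)
  ultimately show ?case
    by (simp add: ordered_prod_def)
next
  case (Suc k)
  let ?h = "psi_density n" and ?X = "ordered_prod n (psi_density n) k t"
  have h: "?h x \<in> carrier_mat n n" for x
    by (simp add: psi_density_def)
  have X: "?X \<in> carrier_mat n n"
    unfolding ordered_prod_def by (rule ordered_prod_carrier[OF h])
  let ?b = "a (Suc k)" and ?s = "t (Suc k)"
  have b: "?b < n" "real ?b \<le> ?s" "?s < real ?b + 1"
    using Suc.prems(1,2)[of "Suc k"] by auto
  have "ordered_prod n ?h (Suc k) t $$ (i, j) = (\<Sum>l<n. ?X $$ (i, l) * ?h ?s $$ (l, j))"
    using X h[of ?s] ij(1) Suc.prems(3) unfolding ordered_prod_Suc[OF h]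
    by (simp add: scalar_prod_def lessThan_atLeast0)
  also have "\<dots> = (\<Sum>l<n. if l = ?b
      then ?X $$ (i, ?b) * (2 / (real n - 1) * sgn (real j - real ?b)) else 0)"
    using b Suc.prems(3) by (intro sum.cong) (auto simp: psi_density_index indicator_def)
  also have "\<dots> = ?X $$ (i, ?b) * (2 / (real n - 1) * sgn (real j - real ?b))"
    using b by simp
  \<comment> \<open>The induction hypothesis at column \<open>?b\<close> instead of
    \<open>j\<close>: its final sign becomes the new factor of the product over adjacent
    indices.\<close>
  also have "?X $$ (i, ?b) = (2 / (real n - 1)) ^ k * of_bool (a 1 = i) *
      (\<Prod>l\<in>{1..<k}. sgn (real (a (l + 1)) - real (a l))) * sgn (real ?b - real (a k))"
    using Suc.prems b by (intro Suc.IH) auto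
  finally show ?case
    using Suc.hyps by (simp add: prod.atLeastLessThan_Suc)
qed

section \<open>Ascents, descents and the Magnus integrand\<close>

lemma asc_plus_des:
  assumes "\<And>l. l \<in> {1..<k} \<Longrightarrow> t l \<noteq> t (l + 1)"
  shows "asc k t + des k t = k - 1"
proof -
  have "asc k t + des k t = card ({i \<in> {1..<k}. t i < t (i + 1)} \<union> {i \<in> {1..<k}. t i > t (i + 1)})"
    unfolding asc_def des_def by (intro card_Un_disjoint[symmetric]) auto
  also have "{i \<in> {1..<k}. t i < t (i + 1)} \<union> {i \<in> {1..<k}. t i > t (i + 1)} = {1..<k}"
    using assms by force
  finally show ?thesis
    by simp
qed

lemma prod_sgn_eq_des:
  assumes "\<And>l. l \<in> {1..<k} \<Longrightarrow> t l \<noteq> t (l + 1)"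
  shows "(\<Prod>l\<in>{1..<k}. sgn (t (l + 1) - t l)) = (-1) ^ des k t"
proof -
  have "(\<Prod>l\<in>{1..<k}. sgn (t (l + 1) - t l)) = (\<Prod>l\<in>{1..<k}. if t l > t (l + 1) then -1 else 1)"
  proof (intro prod.cong refl)
    fix l assume "l \<in> {1..<k}"
    from assms[OF this] show "sgn (t (l + 1) - t l) = (if t l > t (l + 1) then -1 else 1)"
      by (auto simp: sgn_if)
  qed
  also have "\<dots> = (-1) ^ des k t"
    by (subst prod.If_cases) (auto simp: des_def Int_def)
  finally show ?thesis .
qed

text \<open>The right-hand side is the reciprocal of k times the binomial coefficient of k-1 over p,
  which is at most 2^(k-1).\<close>

lemma fact_asc_des_ge:
  assumes "k \<ge> 1" "p + q = k - 1"
  shows "1 / (real k * 2 ^ (k - 1)) \<le> fact p * fact q / fact k"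
proof -
  have "fact p * fact q * real ((k - 1) choose p) = fact (k - 1)"
    using assms binomial_fact_lemma[of p "k - 1"]
    by (metis add_diff_cancel_left' le_add1 of_nat_fact of_nat_mult)
  moreover have "real ((k - 1) choose p) \<le> 2 ^ (k - 1)"
    using binomial_le_pow2[of "k - 1" p] by (metis of_nat_le_iff of_nat_numeral of_nat_power)
  ultimately have "fact (k - 1) \<le> fact p * fact q * (2 :: real) ^ (k - 1)"
    by (metis mult_left_mono fact_ge_zero mult_nonneg_nonneg)
  moreover have "(fact k :: real) = real k * fact (k - 1)"
    using assms by (simp add: fact_reduce)
  ultimately show ?thesis
    using assms by (simp add: field_simps)
qed

definition nonstuttering :: "nat \<Rightarrow> (nat \<Rightarrow> nat) \<Rightarrow> bool" where
  "nonstuttering k a \<longleftrightarrow> (\<forall>l\<in>{1..<k}. a l \<noteq> a (l + 1))"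

text \<open>
  The sign of a product $Q_{a_1} \cdots Q_{a_k}$ is the Magnus sign $(-1)^{\mathrm{des}}$, so the two
  cancel; and $Q_a Q_a = 0$ removes the sequences \<open>a\<close> that do not determine the order
  of consecutive times.
\<close>

lemma magnus_weight_times_prod_sgn:
  assumes t: "\<And>l. l \<in> {1..k} \<Longrightarrow> real (a l) \<le> t l \<and> t l < real (a l) + 1"
  shows "(-1) ^ des k t * (fact (asc k t) * fact (des k t) / fact k)
      * (\<Prod>l\<in>{1..<k}. sgn (real (a (l + 1)) - real (a l))) =
    of_bool (nonstuttering k a) *
      (fact (asc k (real \<circ> a)) * fact (des k (real \<circ> a)) / fact k :: real)"
proof (cases "nonstuttering k a")
  case False
  then obtain l where "l \<in> {1..<k}" "a l = a (l + 1)"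
    by (auto simp: nonstuttering_def)
  then have prod0: "(\<Prod>l\<in>{1..<k}. sgn (real (a (l + 1)) - real (a l))) = 0"
    by (intro prod_zero bexI[of _ l]) auto
  show ?thesis
    using False unfolding prod0 by simp
next
  case True
  \<comment> \<open>Distinct integers differ by at least 1, so their half-open unit intervals are
    ordered as they are.\<close>
  have less_iff: "t l < t (l + 1) \<longleftrightarrow> a l < a (l + 1)" "t (l + 1) < t l \<longleftrightarrow> a (l + 1) < a l"
    if "l \<in> {1..<k}" for l
  proof -
    have "a l \<noteq> a (l + 1)"
      using True that by (auto simp: nonstuttering_def)
    then have "real (a l) + 1 \<le> real (a (l + 1)) \<or> real (a (l + 1)) + 1 \<le> real (a l)"
      by linarith
    then show "t l < t (l + 1) \<longleftrightarrow> a l < a (l + 1)" "t (l + 1) < t l \<longleftrightarrow> a (l + 1) < a l"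
      using t[of l] t[of "l + 1"] that by auto
  qed
  have "asc k t = asc k (real \<circ> a)" "des k t = des k (real \<circ> a)"
    using less_iff by (auto simp: asc_def des_def intro!: arg_cong[where f = card])
  moreover have "(\<Prod>l\<in>{1..<k}. sgn (real (a (l + 1)) - real (a l))) = (-1) ^ des k (real \<circ> a)"
    using prod_sgn_eq_des[of k "real \<circ> a"] True by (simp add: nonstuttering_def)
  ultimately show ?thesis
    using True by (simp add: power_mult_distrib[symmetric])
qed

text \<open>The integrand depends on \<open>t\<close> only through its box \<open>a\<close>, as
  \<open>integral_PiM_psi_base\<close> requires. The row selector \<open>of_bool (a 1 = i)\<close>
  stands in front because it disappears when a column is summed.\<close>

lemma magnus_integrand_psi:
  assumes "k \<ge> 1" "i < n" "j < n"
    and "\<And>l. l \<in> {1..k} \<Longrightarrow> a l < n"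
    and "\<And>l. l \<in> {1..k} \<Longrightarrow> real (a l) \<le> t l \<and> t l < real (a l) + 1"
  shows "(-1) ^ des k t * (fact (asc k t) * fact (des k t) / fact k)
      * ordered_prod n (psi_density n) k t $$ (i, j) =
    of_bool (a 1 = i) * ((2 / (real n - 1)) ^ k * of_bool (nonstuttering k a) *
      (fact (asc k (real \<circ> a)) * fact (des k (real \<circ> a)) / fact k) * sgn (real j - real (a k)))"
  using magnus_weight_times_prod_sgn[of k a t, OF assms(5)]
    ordered_prod_psi[of k i n j a t, OF assms]
  by (simp only: mult_ac)

section \<open>Counting the contributing sequences\<close>

text \<open>Read from the end, the last entry avoids x and every earlier one avoids its successor,
  which leaves n-1 choices each time. In the induction the removed last entry becomes the forbidden
  value for the shorter sequence, so x has to vary.\<close>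

lemma card_nonstuttering:
  assumes "k \<ge> 1" "x < n"
  shows "card {a \<in> {1..k} \<rightarrow>\<^sub>E {..<n}. nonstuttering k a \<and> a k \<noteq> x} = (n - 1) ^ k"
  using assms
proof (induction k arbitrary: x rule: nat_induct_at_least)
  case base
  have "nonstuttering 1 a \<and> a 1 \<noteq> x \<longleftrightarrow> a 1 \<noteq> x" for a
    by (simp add: nonstuttering_def)
  moreover have "{a \<in> {1..1::nat} \<rightarrow>\<^sub>E {..<n}. a 1 \<noteq> x} = {1..1} \<rightarrow>\<^sub>E ({..<n} - {x})"
    unfolding set_eq_iff mem_Collect_eq PiE_iff by auto
  moreover have "card ({1..1::nat} \<rightarrow>\<^sub>E ({..<n} - {x})) = (n - 1) ^ 1"
    using base by (subst card_PiE) simp_all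
  ultimately show ?case
    by (simp only:)
next
  case (Suc k)
  define S where "S k y = {a \<in> {1..k} \<rightarrow>\<^sub>E {..<n}. nonstuttering k a \<and> a k \<noteq> y}" for k y
  have fin: "finite (S k y)" for k y
    unfolding S_def by (rule finite_subset[of _ "{1..k} \<rightarrow>\<^sub>E {..<n}"]) (auto intro!: finite_PiE)
  define ext where "ext p = (snd p)(Suc k := fst p)" for p :: "nat \<times> (nat \<Rightarrow> nat)"
  have step: "nonstuttering (Suc k) a \<longleftrightarrow> nonstuttering k a \<and> a k \<noteq> a (Suc k)" for a
    using Suc.hyps by (auto simp: nonstuttering_def atLeastLessThanSuc)
  have upd: "nonstuttering k (a(Suc k := y)) \<longleftrightarrow> nonstuttering k a" for a y
    by (simp add: nonstuttering_def)
  have interval: "{Suc 0..Suc k} = insert (Suc k) {Suc 0..k}"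
    by (rule atLeastAtMostSuc_conv) simp
  have "bij_betw ext (SIGMA y:{..<n} - {x}. S k y) (S (Suc k) x)"
  \<comment> \<open>The inverse removes the last entry by resetting it to \<open>undefined\<close>,
    the value of extensional functions outside their domain.\<close>
  proof (rule bij_betwI[where g = "\<lambda>a. (a (Suc k), a(Suc k := undefined))"])
    show "ext \<in> (SIGMA y:{..<n} - {x}. S k y) \<rightarrow> S (Suc k) x"
    proof
      fix p assume "p \<in> (SIGMA y:{..<n} - {x}. S k y)"
      then have "fst p < n" "fst p \<noteq> x" "snd p \<in> S k (fst p)"
        by auto
      then show "ext p \<in> S (Suc k) x"
        using PiE_fun_upd[of "fst p" "\<lambda>_. {..<n}" "Suc k" "snd p" "{1..k}"] Suc.hyps
        by (simp add: S_def ext_def step upd interval)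
    qed
    show "(\<lambda>a. (a (Suc k), a(Suc k := undefined))) \<in> S (Suc k) x \<rightarrow> (SIGMA y:{..<n} - {x}. S k y)"
    proof
      fix a assume "a \<in> S (Suc k) x"
      then show "(a (Suc k), a(Suc k := undefined)) \<in> (SIGMA y:{..<n} - {x}. S k y)"
        using fun_upd_in_PiE[of "Suc k" "{1..k}" a "\<lambda>_. {..<n}"] PiE_mem[of a "{1..Suc k}" "\<lambda>_. {..<n}" "Suc k"]
          Suc.hyps
        by (simp add: S_def step upd interval)
    qed
    show "(ext p (Suc k), (ext p)(Suc k := undefined)) = p"
      if "p \<in> (SIGMA y:{..<n} - {x}. S k y)" for p
      using that by (auto simp: ext_def S_def PiE_iff extensional_def fun_eq_iff)
    show "ext (a (Suc k), a(Suc k := undefined)) = a" for a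
      by (simp add: ext_def)
  qed
  then have "card (S (Suc k) x) = card (SIGMA y:{..<n} - {x}. S k y)"
    by (simp add: bij_betw_same_card)
  also have "\<dots> = (\<Sum>y\<in>{..<n} - {x}. card (S k y))"
    using fin by (intro card_SigmaI) auto
  also have "\<dots> = (\<Sum>y\<in>{..<n} - {x}. (n - 1) ^ k)"
    using Suc.IH by (intro sum.cong) (auto simp: S_def)
  also have "\<dots> = (n - 1) ^ Suc k"
    using Suc.prems by simp
  finally show ?case
    by (simp add: S_def)
qed

section \<open>The lower bound for the Magnus terms and divergence\<close>

lemma l1_opnorm_magnus_term_ge:
  assumes n: "n \<ge> 2" and k: "k \<ge> 1"
  shows "2 / real k \<le> l1_opnorm (magnus_term n (psi_base n) (psi_density n) k)"
proof -
  let ?A = "magnus_term n (psi_base n) (psi_density n) k" and ?c = "2 / (real n - 1)"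
  let ?E = "{1..k} \<rightarrow>\<^sub>E {..<n}" and ?j = "n - 1"
  \<comment> \<open>The contribution of \<open>a\<close> to the last column, without the row
    selector.\<close>
  define w where "w a = ?c ^ k * of_bool (nonstuttering k a) *
    (fact (asc k (real \<circ> a)) * fact (des k (real \<circ> a)) / fact k) * sgn (real ?j - real (a k))" for a
  let ?S = "{a \<in> ?E. nonstuttering k a \<and> a k \<noteq> ?j}"
  have c: "?c > 0"
    using n by simp
  have fin: "finite ?E"
    by (intro finite_PiE) auto
  have ak: "a k < n" if "a \<in> ?E" for a
    using PiE_mem[OF that, of k] k by simp
  \<comment> \<open>This is why the last column is taken: no index exceeds n-1, so the final sign is
    never negative.\<close>
  have sgn: "sgn (real ?j - real (a k)) = of_bool (a k \<noteq> ?j)" if "a \<in> ?E" for a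
    using ak[OF that] by (auto simp: sgn_if)
  have entry: "?A $$ (i, ?j) = (\<Sum>a\<in>?E. of_bool (a 1 = i) * w a)" if "i < n" for i
  proof -
    have "?A $$ (i, ?j) = (LINT t|Pi\<^sub>M {1..k} (\<lambda>_. psi_base n).
      (-1) ^ des k t * (fact (asc k t) * fact (des k t) / fact k)
        * ordered_prod n (psi_density n) k t $$ (i, ?j))"
      using that n by (simp add: magnus_term_def)
    also have "\<dots> = (\<Sum>a\<in>?E. of_bool (a 1 = i) * w a)"
      unfolding w_def using that n k
      by (intro integral_PiM_psi_base magnus_integrand_psi) auto
    finally show ?thesis .
  qed
  have w_ge: "?c ^ k * (1 / (real k * 2 ^ (k - 1))) \<le> w a" if "a \<in> ?S" for a
  proof -
    have "asc k (real \<circ> a) + des k (real \<circ> a) = k - 1"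
      using that by (intro asc_plus_des) (auto simp: nonstuttering_def)
    from fact_asc_des_ge[OF k this]
    have "?c ^ k * (1 / (real k * 2 ^ (k - 1)))
        \<le> ?c ^ k * (fact (asc k (real \<circ> a)) * fact (des k (real \<circ> a)) / fact k)"
      using c by (intro mult_left_mono) simp_all
    also have "\<dots> = w a"
      using that sgn[of a] unfolding w_def by simp
    finally show ?thesis .
  qed
  have w_nonneg: "w a \<ge> 0" if "a \<in> ?E" for a
    using c sgn[OF that] unfolding w_def by simp
  \<comment> \<open>The (n-1)^k sequences turn the kth power of 2/(n-1) into 2^k, of which the bound
    on the weights leaves 2/k.\<close>
  have two: "real (n - 1) * ?c = 2"
    using n by (simp add: field_simps)
  have "2 ^ k * (1 / (real k * 2 ^ (k - 1))) = 2 / real k"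
    using k by (cases k) simp_all
  then have "(real (n - 1) * ?c) ^ k * (1 / (real k * 2 ^ (k - 1))) = 2 / real k"
    by (simp only: two)
  then have "2 / real k = real ((n - 1) ^ k) * (?c ^ k * (1 / (real k * 2 ^ (k - 1))))"
    by (simp only: of_nat_power power_mult_distrib mult.assoc)
  also have "\<dots> = (\<Sum>a\<in>?S. ?c ^ k * (1 / (real k * 2 ^ (k - 1))))"
    using card_nonstuttering[OF k, of ?j n] n by simp
  also have "\<dots> \<le> (\<Sum>a\<in>?S. w a)"
    using w_ge by (rule sum_mono)
  also have "\<dots> \<le> (\<Sum>a\<in>?E. w a)"
    using fin w_nonneg by (intro sum_mono2) auto
  \<comment> \<open>Each sequence starts in exactly one row, so its row selectors sum to 1.\<close>
  also have "\<dots> = (\<Sum>a\<in>?E. \<Sum>i<n. of_bool (a 1 = i) * w a)"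
  proof (intro sum.cong refl)
    fix a assume "a \<in> ?E"
    then have "a 1 < n"
      using k PiE_mem[of a "{1..k}" "\<lambda>_. {..<n}" 1] by simp
    moreover have "(\<Sum>i<n. of_bool (a 1 = i) * w a) = (\<Sum>i<n. if a 1 = i then w a else 0)"
      by (intro sum.cong) auto
    ultimately show "w a = (\<Sum>i<n. of_bool (a 1 = i) * w a)"
      by simp
  qed
  also have "\<dots> = (\<Sum>i<n. ?A $$ (i, ?j))"
    by (subst sum.swap) (intro sum.cong refl entry[symmetric], simp)
  also have "\<dots> \<le> (\<Sum>i<n. \<bar>?A $$ (i, ?j)\<bar>)"
    by (intro sum_mono) simp
  also have "\<dots> \<le> l1_opnorm ?A"
    using column_sum_le_l1_opnorm[of ?j ?A] n by (simp add: magnus_term_def)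
  finally show ?thesis .
qed

lemma not_summable_ge_harmonic:
  fixes f :: "nat \<Rightarrow> real"
  assumes "c > 0" and f: "\<And>k. c / real (Suc k) \<le> f k"
  shows "\<not> summable f"
proof
  assume "summable f"
  then have "summable (\<lambda>k. c / real (Suc k))"
    by (rule summable_comparison_test') (use \<open>c > 0\<close> f in \<open>simp del: of_nat_Suc\<close>)
  then have "summable (\<lambda>k. inverse (real (Suc k)))"
    using \<open>c > 0\<close> by (simp only: divide_inverse summable_cmult_iff) simp
  then show False
    \<comment> \<open>The harmonic series used here starts at index 0, with
      \<open>inverse 0 = 0\<close>; shifting the index does not affect summability.\<close>
    using not_summable_harmonic[where 'a = real] summable_Suc_iff[of "\<lambda>k. inverse (real k)"] by simp
qed

lemma not_magnus_absolutely_convergent_psi: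
  assumes "n \<ge> 2"
  shows "\<not> magnus_absolutely_convergent l1_opnorm n (psi_base n) (psi_density n)"
  unfolding magnus_absolutely_convergent_def
  by (intro not_summable_ge_harmonic[of 2] l1_opnorm_magnus_term_ge assms) simp_all

theorem theorem1p12:
  fixes n :: nat
  assumes "n \<ge> 2"
  shows "cumulative_norm l1_opnorm n (psi_base n) (psi_density n) = ereal (2 * real n / (real n - 1))
    \<and> \<not> magnus_absolutely_convergent l1_opnorm n (psi_base n) (psi_density n)"
  using cumulative_norm_psi[OF assms] not_magnus_absolutely_convergent_psi[OF assms] ..

end
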